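(* Consider, for real parameters $\mu$ and $\varepsilon\geq 0$, the diffusive Vlasov equation $$u_t=\varepsilon u_{xx}+\Big(u\cdot\big(u-(\tfrac{1}{\pi}+\mu)\,V*u\big)_x\Big)_x,\qquad V(x)=\cos(x),$$ for $2\pi$-periodic functions $u$ of $x$. For every $\rho$ with $0<\rho<1$ there is $\varepsilon_0=\varepsilon_0(\rho)>0$ such that for all $0\leq\varepsilon<\varepsilon_0$ there exist $\mu=\mu_*(\rho,\varepsilon)\in\mathbb{R}$ and a $2\pi$-periodic, even, time-independent solution $u_*(x;\rho,\varepsilon)$ of this equation with $\mu=\mu_*(\rho,\varepsilon)$, satisfying the normalization $$\int_{-\pi}^{\pi}u_*(x;\rho,\varepsilon)\,\mathrm{d}x=2\pi,\qquad \int_{-\pi}^{\pi}\cos(x)\,u_*(x;\rho,\varepsilon)\,\mathrm{d}x=\rho\pi,$$ and the expansions, as $\varepsilon\to 0$, $$\mu_*(\rho,\varepsilon)=\varepsilon\,\mu_1(\rho)+\mathrm{O}(\varepsilon^2),\qquad u_*(x;\rho,\varepsilon)=1+\rho\cos(x)+\mathrm{O}(\varepsilon),$$ where $$\mu_1(\rho)=\frac{2}{\pi\rho^2}\left(1-\sqrt{1-\rho^2}\right),$$ with limits $\mu_1(\rho)\to 1/\pi$ as $\rho\to 0$ and $\mu_1(\rho)\to 2/\pi$ as $\rho\to 1$.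
   Context: Convolution is over one period: $(V*u)(x)=\int_{-\pi}^{\pi}V(x-y)\,u(y)\,\mathrm{d}y$. The functions $u$ are scalar-valued; subscripts $t,x$ denote partial derivatives. The $\mathrm{O}(\varepsilon)$ term in the expansion of $u_*$ is uniform in $x$ (for fixed $\rho$); $u_*$ is sought in the space of even, $2\pi$-periodic functions of class $H^2$. *)

theory Defs
  imports "HOL-Analysis.Analysis"
begin

definition per_conv :: "(real \<Rightarrow> real) \<Rightarrow> (real \<Rightarrow> real) \<Rightarrow> real \<Rightarrow> real" where
  "per_conv V u x = (LINT y:{-pi..pi}|lborel. V (x - y) * u y)"

definition smooth_per :: "(real \<Rightarrow> real) \<Rightarrow> bool" where
  "smooth_per \<phi> \<longleftrightarrow> periodic_fun_simple \<phi> (2 * pi) \<and> (\<forall>n x. (deriv ^^ n) \<phi> differentiable (at x))"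

definition has_weak_deriv_per :: "(real \<Rightarrow> real) \<Rightarrow> (real \<Rightarrow> real) \<Rightarrow> bool" where
  "has_weak_deriv_per f g \<longleftrightarrow>
     periodic_fun_simple f (2 * pi) \<and> periodic_fun_simple g (2 * pi) \<and>
     set_integrable lborel {-pi..pi} f \<and> set_integrable lborel {-pi..pi} g \<and>
     (\<forall>\<phi>. smooth_per \<phi> \<longrightarrow>
        (LINT x:{-pi..pi}|lborel. f x * deriv \<phi> x) = - (LINT x:{-pi..pi}|lborel. g x * \<phi> x))"

definition L2_per :: "(real \<Rightarrow> real) \<Rightarrow> bool" where
  "L2_per f \<longleftrightarrow> periodic_fun_simple f (2 * pi) \<and>
     set_borel_measurable lborel {-pi..pi} f \<and> set_integrable lborel {-pi..pi} (\<lambda>x. (f x)\<^sup>2)"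

text \<open>
  The periodic Sobolev space of class \<open>H\<^sup>2\<close>. Its elements embed into the continuous functions;
  the continuity clause selects the continuous representative of the a.e.-equivalence class, so
  that pointwise statements about such functions are meaningful.
\<close>

definition H2_per :: "(real \<Rightarrow> real) \<Rightarrow> bool" where
  "H2_per u \<longleftrightarrow> continuous_on UNIV u \<and> L2_per u \<and>
     (\<exists>ux uxx. has_weak_deriv_per u ux \<and> has_weak_deriv_per ux uxx \<and> L2_per ux \<and> L2_per uxx)"

text \<open>
  Strong solutions, with values in \<open>H\<^sup>2\<close>, of
  \[ u_t = \varepsilon u_{xx} + \big(u\,(u - (1/\pi + \mu)\, V * u)_x\big)_x, \qquad V = \cos. \]
  Here \<open>U t x\<close> is \<open>u(x)\<close> at time \<open>t\<close>. The functions \<open>Ux\<close>, \<open>Uxx\<close>, \<open>W\<close> and \<open>F\<close> are \<open>u_x\<close>, \<open>u_{xx}\<close>,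
  the derivative of \<open>u - (1/\pi + \mu) V * u\<close> and the derivative of \<open>u W\<close>. Spatial derivatives are
  weak ones, hence determined up to null sets only, and the equation is required for almost
  every \<open>x\<close>.
\<close>

definition diffusive_vlasov_solution :: "real \<Rightarrow> real \<Rightarrow> (real \<Rightarrow> real \<Rightarrow> real) \<Rightarrow> bool" where
  "diffusive_vlasov_solution \<epsilon> \<mu> U \<longleftrightarrow>
     (\<forall>t. H2_per (U t)) \<and>
     (\<exists>Ux Uxx W F. \<forall>t.
        has_weak_deriv_per (U t) (Ux t) \<and>
        has_weak_deriv_per (Ux t) (Uxx t) \<and>
        has_weak_deriv_per (\<lambda>x. U t x - (1 / pi + \<mu>) * per_conv cos (U t) x) (W t) \<and>
        has_weak_deriv_per (\<lambda>x. U t x * W t x) (F t) \<and>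
        (AE x in lborel. ((\<lambda>s. U s x) has_real_derivative \<epsilon> * Uxx t x + F t x) (at t)))"

definition mu_1 :: "real \<Rightarrow> real" where
  "mu_1 \<rho> = 2 / (pi * \<rho>\<^sup>2) * (1 - sqrt (1 - \<rho>\<^sup>2))"

end

theory Submission
  imports Defs "HOL-Real_Asymp.Real_Asymp"
begin

text \<open>
  For an even positive steady state the flux vanishes, and \<open>V * u = \<rho> \<pi> cos\<close>. Dividing the flux by
  \<open>u\<close> and integrating gives \<open>u + \<epsilon> ln u = A + \<rho> (1 + \<pi> \<mu>) cos x\<close>. The two normalizations turn this
  into \<open>u = 1 + \<rho> cos x - \<epsilon> Q (ln u)\<close>, where \<open>Q\<close> removes the Fourier modes \<open>1\<close> and \<open>cos\<close>; for small
  \<open>\<epsilon>\<close> this is a contraction, and \<open>A\<close>, \<open>\<mu>\<close> are then read off as the removed coefficients. In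
  particular \<open>\<mu> = \<epsilon> / (\<pi>\<^sup>2 \<rho>) \<integral> cos x ln u dx\<close>, whose leading order is an explicit integral. Evenness,
  periodicity and smoothness of \<open>u\<close> follow from the injectivity and smoothness of \<open>z \<mapsto> z + \<epsilon> ln z\<close>.
\<close>

section \<open>Integrals over one period\<close>

text \<open>Bridge between the Lebesgue set integrals of the definitions and the gauge integral, in
  which all computations below are carried out.\<close>

lemma set_lebesgue_integral_eq_integral_continuous:
  fixes f :: "real \<Rightarrow> real"
  assumes "continuous_on {a..b} f"
  shows "set_integrable lborel {a..b} f" "(LINT x:{a..b}|lborel. f x) = integral {a..b} f"
proof -
  show *: "set_integrable lborel {a..b} f"
    unfolding set_integrable_def using borel_integrable_atLeastAtMost'[OF assms]
    by (simp add: set_integrable_def)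
  show "(LINT x:{a..b}|lborel. f x) = integral {a..b} f"
    by (rule set_borel_integral_eq_integral(2)[OF *])
qed

lemma integral_cos_period: "integral {-pi..pi} cos = (0::real)"
  by (rule integral_unique, rule has_integral_eq_rhs,
      rule fundamental_theorem_of_calculus[of "-pi" pi sin cos])
     (auto intro!: derivative_eq_intros simp: has_real_derivative_iff_has_vector_derivative[symmetric])

lemma integral_cos_squared_period: "integral {-pi..pi} (\<lambda>x. cos x * cos x) = (pi::real)"
proof -
  have "((\<lambda>x. cos x * cos x) has_integral (pi / 2 + sin pi * cos pi / 2 - (- pi / 2 + sin (-pi) * cos (-pi) / 2))) {-pi..pi}"
  proof (rule fundamental_theorem_of_calculus)
    fix x :: real assume "x \<in> {-pi..pi}"
    have "sin x * sin x = 1 - cos x * cos x"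
      using sin_cos_squared_add[of x] by (simp add: power2_eq_square)
    moreover have "((\<lambda>x. x / 2 + sin x * cos x / 2) has_real_derivative
        1 / 2 + (cos x * cos x - sin x * sin x) / 2) (at x within {-pi..pi})"
      by (auto intro!: derivative_eq_intros simp: field_simps)
    ultimately have "((\<lambda>x. x / 2 + sin x * cos x / 2) has_real_derivative cos x * cos x) (at x within {-pi..pi})"
      by (simp add: diff_divide_distrib)
    then show "((\<lambda>x. x / 2 + sin x * cos x / 2) has_vector_derivative cos x * cos x) (at x within {-pi..pi})"
      by (simp add: has_real_derivative_iff_has_vector_derivative)
  qed simp
  then show ?thesis by (simp add: integral_unique)
qed

section \<open>Projection away from the Fourier modes \<open>1\<close> and \<open>cos\<close>, and
  the contraction built on it\<close>

text \<open>This is the operator \<open>Q\<close> of the overview: the L2-orthogonal projection onto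
  the complement of the span of \<open>1\<close> and \<open>cos\<close>. The divisors
  \<open>2 * pi\<close> and \<open>pi\<close> are the squared L2 norms of these two functions on a
  period.\<close>

definition strip_modes :: "(real \<Rightarrow> real) \<Rightarrow> real \<Rightarrow> real" where
  "strip_modes f x = f x - integral {-pi..pi} f / (2 * pi)
      - cos x * (integral {-pi..pi} (\<lambda>y. cos y * f y) / pi)"

lemma continuous_on_strip_modes:
  "continuous_on UNIV f \<Longrightarrow> continuous_on UNIV (strip_modes f)"
  unfolding strip_modes_def[abs_def] by (intro continuous_intros) auto

lemma abs_integral_period_le:
  fixes f :: "real \<Rightarrow> real"
  assumes "continuous_on UNIV f" "\<And>x. \<bar>f x\<bar> \<le> B"
  shows "\<bar>integral {-pi..pi} f\<bar> \<le> B * (2 * pi)"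
    and "\<bar>integral {-pi..pi} (\<lambda>y. cos y * f y)\<bar> \<le> B * (2 * pi)"
proof -
  have c: "continuous_on {-pi..pi} f" using assms(1) continuous_on_subset by blast
  have "norm (integral {-pi..pi} f) \<le> B * (pi - (-pi))"
    by (rule integral_bound) (use c assms(2) in auto)
  then show "\<bar>integral {-pi..pi} f\<bar> \<le> B * (2 * pi)" by simp
  have "\<bar>cos y * f y\<bar> \<le> B" for y
    using mult_mono[of "\<bar>cos y\<bar>" 1 "\<bar>f y\<bar>" B] assms(2)[of y] by (simp add: abs_mult)
  then have "norm (integral {-pi..pi} (\<lambda>y. cos y * f y)) \<le> B * (pi - (-pi))"
    by (intro integral_bound) (use c in \<open>auto intro!: continuous_intros\<close>)
  then show "\<bar>integral {-pi..pi} (\<lambda>y. cos y * f y)\<bar> \<le> B * (2 * pi)" by simp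
qed

text \<open>In the sup norm the function itself contributes \<open>B\<close>, its mean at most
  \<open>B\<close>, and its cosine coefficient at most \<open>2 * B\<close>, since the integral over
  length \<open>2 * pi\<close> is divided by \<open>pi\<close> only.\<close>

lemma abs_strip_modes_le:
  assumes "continuous_on UNIV f" "\<And>x. \<bar>f x\<bar> \<le> B"
  shows "\<bar>strip_modes f x\<bar> \<le> 4 * B"
proof -
  note I = abs_integral_period_le[OF assms]
  have a: "\<bar>integral {-pi..pi} f / (2 * pi)\<bar> \<le> B"
    using I(1) by (simp add: abs_divide pos_divide_le_eq)
  have b: "\<bar>integral {-pi..pi} (\<lambda>y. cos y * f y) / pi\<bar> \<le> 2 * B"
    using I(2) by (simp add: abs_divide pos_divide_le_eq mult_ac)
  have "\<bar>cos x * (integral {-pi..pi} (\<lambda>y. cos y * f y) / pi)\<bar> \<le> 2 * B"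
    using mult_mono[OF abs_cos_le_one[of x] b] by (simp add: abs_mult)
  then show ?thesis unfolding strip_modes_def using a assms(2)[of x] by linarith
qed

lemma strip_modes_diff:
  assumes "continuous_on UNIV f" "continuous_on UNIV g"
  shows "strip_modes f x - strip_modes g x = strip_modes (\<lambda>y. f y - g y) x"
proof -
  have i: "f integrable_on {-pi..pi}" "g integrable_on {-pi..pi}"
    "(\<lambda>y. cos y * f y) integrable_on {-pi..pi}" "(\<lambda>y. cos y * g y) integrable_on {-pi..pi}"
    using assms by (auto intro!: integrable_continuous_real continuous_intros
        intro: continuous_on_subset)
  show ?thesis unfolding strip_modes_def
    by (simp add: integral_diff i right_diff_distrib diff_divide_distrib)
qed

lemma integral_strip_modes:
  assumes "continuous_on UNIV f"
  shows "integral {-pi..pi} (strip_modes f) = 0"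
    and "integral {-pi..pi} (\<lambda>x. cos x * strip_modes f x) = 0"
proof -
  define A where "A = integral {-pi..pi} f / (2 * pi)"
  define B where "B = integral {-pi..pi} (\<lambda>y. cos y * f y) / pi"
  have Q: "strip_modes f = (\<lambda>x. f x - A - B * cos x)"
    by (auto simp: strip_modes_def A_def B_def mult.commute)
  have c: "continuous_on {-pi..pi} f" using assms continuous_on_subset by blast
  have hf: "(f has_integral 2 * pi * A) {-pi..pi}"
    using integrable_integral[OF integrable_continuous_real[OF c]] by (simp add: A_def)
  have hcf: "((\<lambda>x. cos x * f x) has_integral pi * B) {-pi..pi}"
    using integrable_integral[OF integrable_continuous_real[of "-pi" pi "\<lambda>x. cos x * f x"]] c
    by (simp add: B_def continuous_intros)
  have hc: "(cos has_integral (0::real)) {-pi..pi}"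
    using integrable_integral[OF integrable_continuous_real[of "-pi" pi "cos::real\<Rightarrow>real"]]
    by (simp add: integral_cos_period continuous_intros)
  have hcc: "((\<lambda>x. cos x * cos x) has_integral (pi::real)) {-pi..pi}"
    using integrable_integral[OF integrable_continuous_real[of "-pi" pi "\<lambda>x. cos x * cos x::real"]]
    by (simp add: integral_cos_squared_period continuous_intros)
  have h1: "((\<lambda>x. A) has_integral 2 * pi * A) {-pi..pi}"
    using has_integral_const_real[of A "-pi" pi] by simp
  show "integral {-pi..pi} (strip_modes f) = 0"
    using has_integral_diff[OF has_integral_diff[OF hf h1] has_integral_mult_right[OF hc, of B]]
    by (simp add: Q integral_unique)
  have "((\<lambda>x. cos x * f x - A * cos x - B * (cos x * cos x)) has_integral 0) {-pi..pi}"
    using has_integral_diff[OF has_integral_diff[OF hcf has_integral_mult_right[OF hc, of A]]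
        has_integral_mult_right[OF hcc, of B]] by (simp add: mult.commute)
  then show "integral {-pi..pi} (\<lambda>x. cos x * strip_modes f x) = 0"
    by (intro integral_unique) (simp add: Q algebra_simps)
qed

text \<open>Banach's theorem on the complete space of bounded continuous functions. The bound
  \<open>B\<close> keeps the iteration inside that space; the Lipschitz constant \<open>K\<close>
  and the operator bound 4 give the contraction factor \<open>4 * \<epsilon> * K\<close>.\<close>

lemma strip_modes_fixed_point:
  fixes l p :: "real \<Rightarrow> real"
  assumes p: "continuous_on UNIV p" "\<And>x. \<bar>p x\<bar> \<le> P"
    and l: "\<And>x. \<bar>l x\<bar> \<le> B" "\<And>x y. \<bar>l x - l y\<bar> \<le> K * \<bar>x - y\<bar>"
    and e: "0 \<le> \<epsilon>" "4 * \<epsilon> * K < 1"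
  shows "\<exists>u. continuous_on UNIV u \<and> (\<forall>x. u x = p x - \<epsilon> * strip_modes (\<lambda>y. l (u y)) x)"
proof -
  have K: "0 \<le> K" using l(2)[of 0 1] by (simp; linarith)
  have lc: "continuous_on UNIV l"
  proof (rule lipschitz_on_continuous_on)
    show "K-lipschitz_on UNIV l"
      by (rule lipschitz_onI) (use l(2) K in \<open>auto simp: dist_real_def\<close>)
  qed
  define T :: "(real \<Rightarrow>\<^sub>C real) \<Rightarrow> (real \<Rightarrow>\<^sub>C real)" where
    "T v = Bcontfun (\<lambda>x. p x - \<epsilon> * strip_modes (\<lambda>y. l (v y)) x)" for v
  have lv: "continuous_on UNIV (\<lambda>y. l (apply_bcontfun v y))" for v :: "real \<Rightarrow>\<^sub>C real"
    by (rule continuous_on_compose2[OF lc]) auto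
  \<comment> \<open>\<open>Bcontfun\<close> can be evaluated pointwise only once its argument is
    known to be bounded and continuous.\<close>
  have T: "apply_bcontfun (T v) x = p x - \<epsilon> * strip_modes (\<lambda>y. l (v y)) x" for v x
  proof -
    have "(\<lambda>x. p x - \<epsilon> * strip_modes (\<lambda>y. l (v y)) x) \<in> bcontfun"
    proof (rule bcontfun_normI)
      show "continuous_on UNIV (\<lambda>x. p x - \<epsilon> * strip_modes (\<lambda>y. l (v y)) x)"
        by (intro continuous_intros p continuous_on_strip_modes lv)
      fix x
      have "\<bar>\<epsilon> * strip_modes (\<lambda>y. l (v y)) x\<bar> \<le> \<epsilon> * (4 * B)"
        using abs_strip_modes_le[OF lv l(1), of v x] e(1) by (simp add: abs_mult mult_left_mono)
      then show "norm (p x - \<epsilon> * strip_modes (\<lambda>y. l (v y)) x) \<le> P + \<epsilon> * (4 * B)"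
        using p(2)[of x] unfolding real_norm_def by linarith
    qed
    then show ?thesis by (simp add: T_def Bcontfun_inverse)
  qed
  have "dist (T v) (T w) \<le> (4 * \<epsilon> * K) * dist v w" for v w
  proof (rule dist_bound)
    fix x
    have "\<bar>l (v y) - l (w y)\<bar> \<le> K * dist v w" for y
      using l(2)[of "v y" "w y"] dist_bounded[of v y w] K
      by (smt (verit) dist_real_def mult_left_mono)
    then have "\<bar>strip_modes (\<lambda>y. l (v y)) x - strip_modes (\<lambda>y. l (w y)) x\<bar> \<le> 4 * (K * dist v w)"
      unfolding strip_modes_diff[OF lv lv]
      by (intro abs_strip_modes_le continuous_intros lv) auto
    then have "\<epsilon> * \<bar>strip_modes (\<lambda>y. l (v y)) x - strip_modes (\<lambda>y. l (w y)) x\<bar> \<le> \<epsilon> * (4 * (K * dist v w))"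
      using e(1) by (rule mult_left_mono)
    moreover have "apply_bcontfun (T v) x - apply_bcontfun (T w) x
        = - (\<epsilon> * (strip_modes (\<lambda>y. l (v y)) x - strip_modes (\<lambda>y. l (w y)) x))"
      unfolding T by (simp add: right_diff_distrib)
    then have "dist (T v x) (T w x) = \<epsilon> * \<bar>strip_modes (\<lambda>y. l (v y)) x - strip_modes (\<lambda>y. l (w y)) x\<bar>"
      using e(1) by (simp only: dist_real_def abs_minus_cancel abs_mult abs_of_nonneg)
    ultimately show "dist (T v x) (T w x) \<le> (4 * \<epsilon> * K) * dist v w" by (simp add: mult_ac)
  qed
  then have "\<exists>!v. T v = v"
    using e K by (intro banach_fix_type[of "4 * \<epsilon> * K"]) auto
  then obtain v where v: "T v = v" by blast
  have "\<forall>x. v x = p x - \<epsilon> * strip_modes (\<lambda>y. l (v y)) x" by (rule allI, rule T[of v, unfolded v])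
  moreover have "continuous_on UNIV v" by auto
  ultimately show ?thesis by blast
qed

section \<open>The fixed-point equation with the logarithm\<close>

lemma abs_ln_diff_le:
  fixes x y :: real
  assumes "0 < a" "a \<le> x" "a \<le> y"
  shows "\<bar>ln x - ln y\<bar> \<le> \<bar>x - y\<bar> / a"
proof -
  have *: "ln s - ln t \<le> \<bar>s - t\<bar> / a" if "a \<le> s" "a \<le> t" for s t :: real
  proof -
    have "ln s - ln t \<le> (s - t) / t" using that assms by (intro ln_diff_le) auto
    also have "\<dots> \<le> \<bar>s - t\<bar> / t" using that assms by (intro divide_right_mono) auto
    also have "\<dots> \<le> \<bar>s - t\<bar> / a" using that assms by (intro divide_left_mono) auto
    finally show ?thesis .
  qed
  show ?thesis using *[OF assms(2,3)] *[OF assms(3,2)] by (simp add: abs_minus_commute)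
qed

text \<open>Here \<open>m\<close> is the minimum of \<open>1 + \<rho> * cos x\<close>, and
  \<open>L\<close> bounds the absolute value of \<open>ln\<close> on the interval from
  \<open>m / 2\<close> to 2. On that interval \<open>ln\<close> has Lipschitz constant
  \<open>2 / m\<close>, so \<open>16 * \<epsilon> \<le> m\<close> makes the contraction factor at
  most 1/2. The condition \<open>8 * \<epsilon> * L \<le> m\<close> keeps the deviation
  \<open>4 * L * \<epsilon>\<close> below \<open>m / 2\<close>.\<close>

lemma log_fixed_point:
  fixes \<rho> \<epsilon> :: real
  defines "m \<equiv> 1 - \<rho>"
  defines "L \<equiv> - ln (m / 2)"
  assumes r: "0 < \<rho>" "\<rho> < 1" and e: "0 \<le> \<epsilon>" "16 * \<epsilon> \<le> m" "8 * \<epsilon> * L \<le> m"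
  shows "\<exists>u. continuous_on UNIV u
    \<and> (\<forall>x. u x = 1 + \<rho> * cos x - \<epsilon> * strip_modes (\<lambda>y. ln (u y)) x)
    \<and> (\<forall>x. m / 2 \<le> u x \<and> \<bar>u x - (1 + \<rho> * cos x)\<bar> \<le> 4 * L * \<epsilon>)"
proof -
  have m: "0 < m" "m < 1" using r by (auto simp: m_def)
  \<comment> \<open>Truncating the argument makes \<open>ln\<close> globally Lipschitz; a posteriori the fixed point never
    leaves the range where the truncation is inactive.\<close>
  define c where "c z = max (m / 2) (min 2 z)" for z :: real
  have c: "m / 2 \<le> c z" "c z \<le> 2" "0 < c z" for z using m by (auto simp: c_def)
  have cL: "\<bar>c x - c y\<bar> \<le> \<bar>x - y\<bar>" for x y by (auto simp: c_def)
  have lb: "\<bar>ln z\<bar> \<le> L" if "m / 2 \<le> z" "z \<le> 2" for z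
  proof -
    have "ln (m / 2) \<le> ln z" using that m by (intro ln_mono) auto
    moreover have "ln z \<le> ln 2" using that m by (intro ln_mono) auto
    \<comment> \<open>\<open>L\<close> equals \<open>ln 2 - ln m\<close>, and \<open>ln m\<close> is
      negative.\<close>
    moreover have "ln 2 \<le> L" using m by (simp add: L_def ln_div)
    ultimately show ?thesis by (simp add: L_def)
  qed
  have bd: "\<bar>1 + \<rho> * cos x\<bar> \<le> 2" for x
  proof -
    have "\<bar>\<rho> * cos x\<bar> \<le> 1"
      using mult_mono[OF less_imp_le[OF r(2)] abs_cos_le_one[of x]] r by (simp add: abs_mult)
    then show ?thesis by linarith
  qed
  have "\<exists>u. continuous_on UNIV u \<and> (\<forall>x. u x = 1 + \<rho> * cos x - \<epsilon> * strip_modes (\<lambda>y. ln (c (u y))) x)"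
  proof (rule strip_modes_fixed_point)
    show "continuous_on UNIV (\<lambda>x. 1 + \<rho> * cos x)" by (intro continuous_intros)
    show "\<bar>1 + \<rho> * cos x\<bar> \<le> 2" for x by (rule bd)
    show "\<bar>ln (c x)\<bar> \<le> L" for x using c by (intro lb)
    show "\<bar>ln (c x) - ln (c y)\<bar> \<le> (2 / m) * \<bar>x - y\<bar>" for x y
    proof -
      have "\<bar>ln (c x) - ln (c y)\<bar> \<le> \<bar>c x - c y\<bar> / (m / 2)" using m c by (intro abs_ln_diff_le) auto
      also have "\<dots> \<le> \<bar>x - y\<bar> / (m / 2)" using m cL by (intro divide_right_mono) auto
      finally show ?thesis by (simp add: field_simps)
    qed
    show "4 * \<epsilon> * (2 / m) < 1" using m e by (simp add: field_simps)
  qed (use e in auto)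
  then obtain u where u: "continuous_on UNIV u"
    "\<And>x. u x = 1 + \<rho> * cos x - \<epsilon> * strip_modes (\<lambda>y. ln (c (u y))) x" by blast
  have cc: "continuous_on UNIV (\<lambda>y. ln (c (u y)))"
  proof -
    have "continuous_on UNIV (\<lambda>y. c (u y))" unfolding c_def using u(1) by (intro continuous_intros)
    then show ?thesis using c(3) by (intro continuous_intros) (auto simp: less_imp_neq[symmetric])
  qed
  have dev: "\<bar>u x - (1 + \<rho> * cos x)\<bar> \<le> 4 * L * \<epsilon>" for x
  proof -
    have "\<bar>strip_modes (\<lambda>y. ln (c (u y))) x\<bar> \<le> 4 * L"
      using c by (intro abs_strip_modes_le cc lb)
    then have "\<epsilon> * \<bar>strip_modes (\<lambda>y. ln (c (u y))) x\<bar> \<le> \<epsilon> * (4 * L)" using e(1) by (rule mult_left_mono)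
    moreover have "\<bar>u x - (1 + \<rho> * cos x)\<bar> = \<epsilon> * \<bar>strip_modes (\<lambda>y. ln (c (u y))) x\<bar>"
      using u(2)[of x] e(1) by (simp add: abs_mult)
    ultimately show ?thesis by (simp add: mult_ac)
  qed
  \<comment> \<open>Since \<open>\<rho> = 1 - m\<close>, the unperturbed profile lies between
    \<open>m\<close> and \<open>2 - m\<close>; a deviation of at most \<open>m / 2\<close> leaves
    room on both sides.\<close>
  have rg: "m / 2 \<le> u x \<and> u x \<le> 2" for x
  proof -
    have "\<bar>\<rho> * cos x\<bar> \<le> \<rho>" using r mult_left_mono[OF abs_cos_le_one[of x], of \<rho>] by (simp add: abs_mult)
    then have "- \<rho> \<le> \<rho> * cos x" "\<rho> * cos x \<le> \<rho>" by linarith+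
    moreover have "4 * L * \<epsilon> \<le> m / 2" using e(3) by (simp add: mult_ac)
    ultimately show ?thesis using dev[of x] m_def m unfolding abs_le_iff by linarith
  qed
  have cu: "c (u x) = u x" for x using rg[of x] by (auto simp: c_def)
  have "\<forall>x. u x = 1 + \<rho> * cos x - \<epsilon> * strip_modes (\<lambda>y. ln (u y)) x"
    using u(2) unfolding cu by blast
  then show ?thesis using u(1) rg dev by blast
qed

section \<open>The explicit integral behind \<open>mu_1\<close>\<close>

lemma integral_cos_ln_one_plus_cos:
  fixes \<rho> :: real
  assumes "0 < \<rho>" "\<rho> < 1"
  shows "integral {-pi..pi} (\<lambda>x. cos x * ln (1 + \<rho> * cos x)) = 2 * pi / \<rho> * (1 - sqrt (1 - \<rho>\<^sup>2))"
proof -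
  define s where "s = sqrt (1 - \<rho>\<^sup>2)"
  \<comment> \<open>\<open>r\<close> factors \<open>(1 + r\<^sup>2) (1 + \<rho> cos x) = \<bar>1 + r e\<^sup>i\<^sup>x\<bar>\<^sup>2\<close>, and \<open>\<theta> x\<close> below is the argument of
    \<open>1 + r e\<^sup>i\<^sup>x\<close>; this gives an antiderivative continuous on the whole period.\<close>
  define r where "r = (1 - s) / \<rho>"
  have s2: "s\<^sup>2 = 1 - \<rho>\<^sup>2" and s: "0 < s" "s < 1"
    using assms power_less_one_iff[of \<rho> 2] by (auto simp: s_def)
  have r0: "0 < r" using assms s by (simp add: r_def)
  have r2: "r\<^sup>2 * (1 + s) = 1 - s"
  proof -
    have "r\<^sup>2 * (1 + s) = (1 - s) * (1 - s\<^sup>2) / \<rho>\<^sup>2"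
      by (simp add: r_def power_divide power2_eq_square algebra_simps)
    then show ?thesis using s2 assms by simp
  qed
  have rr: "r\<^sup>2 = (1 - s) / (1 + s)" using r2 s by (simp add: field_simps)
  have r1: "r < 1"
  proof -
    have "r\<^sup>2 < 1" using s by (simp add: rr)
    then show ?thesis using r0 by (simp add: abs_square_less_1)
  qed
  \<comment> \<open>This matches the coefficients of \<open>cos x\<close> in the factorization; the
    constant terms agree trivially.\<close>
  have rs: "2 * r = \<rho> * (1 + r\<^sup>2)" 
  proof -
    have "r * \<rho> = 1 - s" using assms by (simp add: r_def)
    then have "2 * (r * \<rho>) * (1 + s) = 2 * (1 - s) * (1 + s)" by (simp only:)
    also have "\<dots> = 2 * (1 - s\<^sup>2)" by (simp add: algebra_simps power2_eq_square)
    finally have "2 * (r * \<rho>) * (1 + s) = 2 * (1 - s\<^sup>2)" .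
    then have "2 * r * (\<rho> * (1 + s)) = 2 * (1 - s\<^sup>2)" by (simp only: mult.assoc)
    moreover have "\<rho> * (1 + r\<^sup>2) * (\<rho> * (1 + s)) = \<rho>\<^sup>2 * (1 + s + r\<^sup>2 * (1 + s))"
      by (simp add: algebra_simps power2_eq_square)
    ultimately have "2 * r * (\<rho> * (1 + s)) = \<rho> * (1 + r\<^sup>2) * (\<rho> * (1 + s))"
      unfolding r2 s2 by simp
    then show ?thesis using assms s by simp
  qed
  define \<theta> where "\<theta> x = arctan (r * sin x / (1 + r * cos x))" for x
  \<comment> \<open>Integration by parts leaves
    \<open>\<rho> * sin^2 x / (1 + \<rho> * cos x)\<close>, which division with remainder turns into
    \<open>1 / \<rho> - cos x - (s^2 / \<rho>) / (1 + \<rho> * cos x)\<close>. The last quotient is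
    integrated through \<open>x - 2 * \<theta> x\<close>.\<close>
  define G where "G x = sin x * ln (1 + \<rho> * cos x) + x / \<rho> - sin x
      - s / \<rho> * (x - 2 * \<theta> x)" for x
  have pos: "0 < 1 + t * cos x" if "0 < t" "t < 1" for t x :: real
  proof -
    have "\<bar>t * cos x\<bar> \<le> t" using that mult_left_mono[OF abs_cos_le_one[of x], of t] by (simp add: abs_mult)
    then show ?thesis using that by linarith
  qed
  have "((\<lambda>x. cos x * ln (1 + \<rho> * cos x)) has_integral (G pi - G (-pi))) {-pi..pi}"
  proof (rule fundamental_theorem_of_calculus)
    fix x :: real assume "x \<in> {-pi..pi}"
    define C where "C = cos x"
    define S where "S = sin x"
    have S2: "S * S = 1 - C * C" using sin_cos_squared_add[of x] by (simp add: C_def S_def power2_eq_square)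
    have pr: "0 < 1 + \<rho> * C" "0 < 1 + r * C" using pos assms r0 r1 by (auto simp: C_def)
    have den: "(1 + r * C)\<^sup>2 + (r * S)\<^sup>2 = (1 + r\<^sup>2) * (1 + \<rho> * C)"
    proof -
      have "(1 + r * C)\<^sup>2 + (r * S)\<^sup>2 = 1 + 2 * r * C + r\<^sup>2 * (C * C + S * S)"
        by (simp add: power2_eq_square algebra_simps)
      also have "\<dots> = 1 + r\<^sup>2 + (2 * r) * C" using S2 by simp
      finally show ?thesis unfolding rs by (simp add: algebra_simps)
    qed
    \<comment> \<open>The derivative of the argument of \<open>1 + r e^(ix)\<close> is the real part
      of \<open>r e^(ix) / (1 + r e^(ix))\<close>.\<close>
    have d\<theta>: "(\<theta> has_real_derivative
        (r * C + r\<^sup>2) / ((1 + r\<^sup>2) * (1 + \<rho> * C))) (at x)"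
    proof -
      have "(\<theta> has_real_derivative
        inverse (1 + (r * S / (1 + r * C))\<^sup>2) * ((r * C * (1 + r * C) - r * S * (- (r * S))) / ((1 + r * C) * (1 + r * C)))) (at x)"
        using pr(2) unfolding \<theta>_def[abs_def] by (auto intro!: derivative_eq_intros simp: C_def S_def)
      moreover have "inverse (1 + (r * S / (1 + r * C))\<^sup>2) = (1 + r * C)\<^sup>2 / ((1 + r * C)\<^sup>2 + (r * S)\<^sup>2)"
        using pr(2) by (simp add: power_divide field_simps)
      moreover have "r * C * (1 + r * C) - r * S * (- (r * S)) = r * C + r\<^sup>2 * (C * C + S * S)"
        by (simp add: power2_eq_square algebra_simps)
      then have "r * C * (1 + r * C) - r * S * (- (r * S)) = r * C + r\<^sup>2" using S2 by simp
      moreover have "(1 + r * C)\<^sup>2 / D * (N / ((1 + r * C) * (1 + r * C))) = N / D" for N D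
        using pr(2) by (simp add: power2_eq_square)
      ultimately show ?thesis by (simp only: den)
    qed
    \<comment> \<open>The derivative of \<open>x - 2 * \<theta> x\<close> is the Poisson kernel
      \<open>(1 - r^2) / (1 + 2 r cos x + r^2)\<close>, and
      \<open>s = (1 - r^2) / (1 + r^2)\<close>.\<close>
    have e1: "1 - 2 * ((r * C + r\<^sup>2) / ((1 + r\<^sup>2) * (1 + \<rho> * C))) = s / (1 + \<rho> * C)"
    proof -
      have p: "0 < 1 + r\<^sup>2" by (simp add: add_pos_nonneg)
      have "1 - r\<^sup>2 = s * (1 + r\<^sup>2)" using r2 by (simp add: algebra_simps)
      moreover have "(1 + r\<^sup>2) * (1 + \<rho> * C) - 2 * (r * C + r\<^sup>2) = 1 - r\<^sup>2 + (\<rho> * (1 + r\<^sup>2) - 2 * r) * C"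
        by (simp add: algebra_simps)
      ultimately have "(1 + r\<^sup>2) * (1 + \<rho> * C) - 2 * (r * C + r\<^sup>2) = s * (1 + r\<^sup>2)" using rs by simp
      moreover have "1 - 2 * ((r * C + r\<^sup>2) / ((1 + r\<^sup>2) * (1 + \<rho> * C)))
          = ((1 + r\<^sup>2) * (1 + \<rho> * C) - 2 * (r * C + r\<^sup>2)) / ((1 + r\<^sup>2) * (1 + \<rho> * C))"
        using p pr by (simp add: diff_divide_distrib)
      ultimately show ?thesis using p pr by simp
    qed
    have "(G has_real_derivative (C * ln (1 + \<rho> * C) + S * (- (\<rho> * S) / (1 + \<rho> * C)) + 1 / \<rho> - C
        - s / \<rho> * (1 - 2 * ((r * C + r\<^sup>2) / ((1 + r\<^sup>2) * (1 + \<rho> * C)))))) (at x)"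
      unfolding G_def[abs_def] using pr assms
      by (auto intro!: derivative_eq_intros d\<theta> simp: C_def S_def mult_ac)
    moreover have "C * ln (1 + \<rho> * C) + S * (- (\<rho> * S) / (1 + \<rho> * C)) + 1 / \<rho> - C
        - s / \<rho> * (s / (1 + \<rho> * C)) = C * ln (1 + \<rho> * C)"
    proof -
      have "S * (- (\<rho> * S) / (1 + \<rho> * C)) - s / \<rho> * (s / (1 + \<rho> * C))
          = - (\<rho>\<^sup>2 * (S * S) + s\<^sup>2) / (\<rho> * (1 + \<rho> * C))"
        using assms pr by (simp add: divide_simps power2_eq_square) 
      also have "\<rho>\<^sup>2 * (S * S) + s\<^sup>2 = (1 - \<rho> * C) * (1 + \<rho> * C)"
        unfolding S2 s2 by (simp add: algebra_simps power2_eq_square)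
      also have "- ((1 - \<rho> * C) * (1 + \<rho> * C)) / (\<rho> * (1 + \<rho> * C)) = - (1 - \<rho> * C) / \<rho>"
        unfolding mult_minus_left[symmetric]
        by (rule mult_divide_mult_cancel_right) (use pr(1) in simp)
      also have "\<dots> = C - 1 / \<rho>"
        using assms by (simp add: field_simps)
      finally show ?thesis by simp
    qed
    ultimately have "(G has_real_derivative cos x * ln (1 + \<rho> * cos x)) (at x)"
      unfolding e1 by (simp only: C_def)
    then show "(G has_vector_derivative cos x * ln (1 + \<rho> * cos x)) (at x within {-pi..pi})"
      using has_field_derivative_at_within has_real_derivative_iff_has_vector_derivative by blast
  qed simp
  \<comment> \<open>All terms with \<open>sin\<close> vanish at the endpoints, including
    \<open>\<theta>\<close>; only the two linear terms survive.\<close>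
  moreover have "G pi - G (-pi) = 2 * pi / \<rho> * (1 - s)"
    using assms by (simp add: G_def \<theta>_def field_simps)
  ultimately show ?thesis by (simp add: s_def integral_unique)
qed

section \<open>Classical derivatives as weak ones, and convolution with the cosine\<close>

text \<open>Integration by parts against a periodic test function: the boundary terms at
  \<open>-pi\<close> and \<open>pi\<close> cancel by periodicity.\<close>

lemma has_weak_deriv_perI:
  assumes d: "\<And>x. (f has_real_derivative g x) (at x)" and g: "continuous_on UNIV g"
    and per: "\<And>x. f (x + 2 * pi) = f x" "\<And>x. g (x + 2 * pi) = g x"
  shows "has_weak_deriv_per f g"
proof -
  have fc: "continuous_on UNIV f" using d DERIV_isCont continuous_at_imp_continuous_on by blast
  have sub: "continuous_on {-pi..pi} h" if "continuous_on UNIV h" for h :: "real \<Rightarrow> real"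
    using that continuous_on_subset by blast
  have ibp: "(LINT x:{-pi..pi}|lborel. f x * deriv \<phi> x) = - (LINT x:{-pi..pi}|lborel. g x * \<phi> x)"
    if "smooth_per \<phi>" for \<phi>
  proof -
    have p: "\<phi> pi = \<phi> (-pi)"
    proof -
      have "\<phi> (-pi + 2 * pi) = \<phi> (-pi)" using that unfolding smooth_per_def periodic_fun_simple_def by blast
      then show ?thesis by simp
    qed
    have "(deriv ^^ 0) \<phi> differentiable at x" "(deriv ^^ 1) \<phi> differentiable at x" for x
      using that unfolding smooth_per_def by blast+
    then have df: "\<phi> differentiable at x" "deriv \<phi> differentiable at x" for x by simp_all
    have d\<phi>: "(\<phi> has_real_derivative deriv \<phi> x) (at x)" for x
      using df(1) DERIV_deriv_iff_real_differentiable by blast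
    have \<phi>c: "continuous_on UNIV \<phi>" "continuous_on UNIV (deriv \<phi>)"
      using df by (auto intro!: continuous_at_imp_continuous_on differentiable_imp_continuous_within)
    have c1: "continuous_on UNIV (\<lambda>x. f x * deriv \<phi> x)" and c2: "continuous_on UNIV (\<lambda>x. g x * \<phi> x)"
      using fc g \<phi>c by (auto intro!: continuous_intros)
    have "((\<lambda>x. f x * deriv \<phi> x + g x * \<phi> x) has_integral f pi * \<phi> pi - f (-pi) * \<phi> (-pi)) {-pi..pi}"
    proof (rule fundamental_theorem_of_calculus)
      fix x
      have "((\<lambda>x. f x * \<phi> x) has_real_derivative f x * deriv \<phi> x + g x * \<phi> x) (at x)"
        by (auto intro!: derivative_eq_intros d d\<phi>)
      then show "((\<lambda>x. f x * \<phi> x) has_vector_derivative f x * deriv \<phi> x + g x * \<phi> x) (at x within {-pi..pi})"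
        using has_field_derivative_at_within has_real_derivative_iff_has_vector_derivative by blast
    qed simp
    moreover have "f pi = f (-pi)" using per(1)[of "-pi"] by simp
    ultimately have "integral {-pi..pi} (\<lambda>x. f x * deriv \<phi> x + g x * \<phi> x) = 0"
      using p by (simp add: integral_unique)
    then show ?thesis
      using sub[OF c1] sub[OF c2]
      by (simp add: set_lebesgue_integral_eq_integral_continuous integral_add integrable_continuous_real
          eq_neg_iff_add_eq_0)
  qed
  show ?thesis unfolding has_weak_deriv_per_def
    using per ibp sub[OF fc] sub[OF g]
    by (simp add: periodic_fun_simple_def set_lebesgue_integral_eq_integral_continuous)
qed

lemma L2_perI:
  assumes "continuous_on UNIV f" "\<And>x. f (x + 2 * pi) = f x"
  shows "L2_per f"
proof -
  have c: "continuous_on {-pi..pi} f" using assms(1) continuous_on_subset by blast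
  have "set_borel_measurable lborel {-pi..pi} f"
    using set_lebesgue_integral_eq_integral_continuous(1)[OF c]
    unfolding set_integrable_def set_borel_measurable_def by (rule borel_measurable_integrable)
  then show ?thesis unfolding L2_per_def periodic_fun_simple_def
    using assms(2) c
    by (auto intro!: set_lebesgue_integral_eq_integral_continuous(1) continuous_intros)
qed

text \<open>By the addition formula the convolution has a \<open>cos x\<close> and a
  \<open>sin x\<close> part; the latter carries the integral of an odd function.\<close>

lemma per_conv_cos_even:
  assumes c: "continuous_on UNIV u" and even: "\<And>x. u (- x) = u x"
  shows "per_conv cos u x = cos x * integral {-pi..pi} (\<lambda>y. cos y * u y)"
proof -
  have ci: "(\<lambda>y. cos y * u y) integrable_on {-pi..pi}" "(\<lambda>y. sin y * u y) integrable_on {-pi..pi}"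
    using c by (auto intro!: integrable_continuous_real continuous_intros intro: continuous_on_subset)
  have "integral {-pi..- (-pi)} (\<lambda>y. sin (-y) * u (-y)) = integral {-pi..pi} (\<lambda>y. sin y * u y)"
    by (rule Henstock_Kurzweil_Integration.integral_reflect_real[where f = "\<lambda>y. sin y * u y"])
  then have "integral {-pi..pi} (\<lambda>y. - (sin y * u y)) = integral {-pi..pi} (\<lambda>y. sin y * u y)"
    by (simp only: sin_minus even mult_minus_left minus_minus)
  then have s0: "integral {-pi..pi} (\<lambda>y. sin y * u y) = 0" by simp
  have "continuous_on {-pi..pi} (\<lambda>y. cos (x - y) * u y)"
    using c by (auto intro!: continuous_intros intro: continuous_on_subset)
  then have "per_conv cos u x = integral {-pi..pi} (\<lambda>y. cos (x - y) * u y)"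
    unfolding per_conv_def by (rule set_lebesgue_integral_eq_integral_continuous)
  also have "\<dots> = integral {-pi..pi} (\<lambda>y. cos x * (cos y * u y) + sin x * (sin y * u y))"
    by (simp add: cos_diff algebra_simps)
  also have "\<dots> = cos x * integral {-pi..pi} (\<lambda>y. cos y * u y)"
    using ci s0 by (subst integral_add) (auto intro: integrable_on_mult_right)
  finally show ?thesis .
qed

section \<open>From the integrated equation to a steady state\<close>

lemma plus_log_strict_mono:
  fixes \<epsilon> :: real
  assumes "0 \<le> \<epsilon>" "0 < y" "y < z"
  shows "y + \<epsilon> * ln y < z + \<epsilon> * ln z"
  using assms mult_left_mono[of "ln y" "ln z" \<epsilon>] by simp

lemma plus_log_inj:
  fixes \<epsilon> :: real
  assumes "0 \<le> \<epsilon>" "0 < y" "0 < z" "y + \<epsilon> * ln y = z + \<epsilon> * ln z"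
  shows "y = z"
  using plus_log_strict_mono[of \<epsilon> y z] plus_log_strict_mono[of \<epsilon> z y] assms
  by (cases y z rule: linorder_cases) auto

text \<open>Implicit differentiation for a \<open>u\<close> known only to be continuous.
  Caratheodory's slope functions \<open>q\<close> of \<open>h\<close> and \<open>k\<close> of
  \<open>s\<close> satisfy \<open>k y * (y - x) = q (u y) * (u y - u x)\<close>, so the difference
  quotient of \<open>u\<close> is \<open>k y / q (u y)\<close> wherever the denominator is
  nonzero.\<close>

lemma has_real_derivative_implicit:
  fixes h u s :: "real \<Rightarrow> real"
  assumes "isCont u x" "(h has_real_derivative h') (at (u x))" "h' \<noteq> 0"
    and hu: "\<And>y. h (u y) = s y" and "(s has_real_derivative s') (at x)"
  shows "(u has_real_derivative s' / h') (at x)"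
proof -
  obtain q where q: "\<And>z. h z - h (u x) = q z * (z - u x)" "isCont q (u x)" "q (u x) = h'"
    using assms(2) unfolding CARAT_DERIV by blast
  obtain k where k: "\<And>z. s z - s x = k z * (z - x)" "isCont k x" "k x = s'"
    using assms(5) unfolding CARAT_DERIV by blast
  have qu: "isCont (\<lambda>y. q (u y)) x" using isCont_o2[OF assms(1) q(2)] .
  have "((\<lambda>y. k y / q (u y)) \<longlongrightarrow> s' / h') (at x)"
    using k(2,3) qu q(3) assms(3) by (auto intro!: tendsto_eq_intros simp: isCont_def)
  moreover have "\<forall>\<^sub>F y in at x. q (u y) \<noteq> 0"
    using qu q(3) assms(3) by (intro tendsto_imp_eventually_ne[of _ h']) (auto simp: isCont_def)
  then have "\<forall>\<^sub>F y in at x. k y / q (u y) = (u y - u x) / (y - x)"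
    using eventually_neq_at_within[of x]
  proof eventually_elim
    case (elim y)
    have "k y * (y - x) = q (u y) * (u y - u x)" using k(1)[of y] q(1)[of "u y"] hu by simp
    then show ?case using elim by (simp add: field_simps)
  qed
  ultimately show ?thesis unfolding has_field_derivative_iff
    by (simp cong: tendsto_cong) 
qed

lemma steady_state_solution:
  fixes u :: "real \<Rightarrow> real" and \<epsilon> \<kappa> A M :: real
  assumes e: "0 \<le> \<epsilon>" and u: "continuous_on UNIV u" "\<And>x. 0 < u x"
    and eq: "\<And>x. u x + \<epsilon> * ln (u x) = A + (1 / pi + \<kappa>) * M * cos x"
    and M: "integral {-pi..pi} (\<lambda>y. cos y * u y) = M"
  shows "diffusive_vlasov_solution \<epsilon> \<kappa> (\<lambda>t. u)" and "u (- x) = u x"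
proof -
  \<comment> \<open>The right-hand side of \<open>eq\<close> depends on \<open>x\<close> only
    through \<open>cos x\<close>; injectivity passes this on to \<open>u\<close>, giving evenness
    and periodicity together.\<close>
  have sym: "u x = u y" if "cos x = cos y" for x y
    using that eq[of x] eq[of y] by (intro plus_log_inj[OF e u(2) u(2)]) simp
  show ev: "u (- x) = u x" for x by (rule sym) simp
  have per: "u (x + 2 * pi) = u x" for x by (rule sym) simp
  define a where "a = (1 / pi + \<kappa>) * M"
  \<comment> \<open>Implicit differentiation of
    \<open>u + \<epsilon> * ln u = A + a * cos x\<close>; \<open>uxx\<close> is then the quotient
    rule.\<close>
  define ux where "ux x = - a * sin x / (1 + \<epsilon> / u x)" for x
  define uxx where "uxx x = (- a * cos x * (1 + \<epsilon> / u x) - (- a * sin x) * (- \<epsilon> * ux x / (u x * u x)))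
      / ((1 + \<epsilon> / u x) * (1 + \<epsilon> / u x))" for x
  have pos: "0 < 1 + \<epsilon> / u x" for x using e u(2)[of x] by (simp add: add_pos_nonneg)
  have nz: "u x \<noteq> 0" "1 + \<epsilon> / u x \<noteq> 0" for x using u(2)[of x] pos[of x] by simp_all
  have du: "(u has_real_derivative ux x) (at x)" for x
    unfolding ux_def
  proof (rule has_real_derivative_implicit)
    show "isCont u x" using u(1) by (simp add: continuous_on_eq_continuous_at)
    show "((\<lambda>z. z + \<epsilon> * ln z) has_real_derivative 1 + \<epsilon> / u x) (at (u x))"
      using u(2)[of x] by (auto intro!: derivative_eq_intros)
    show "u y + \<epsilon> * ln (u y) = A + a * cos y" for y using eq by (simp add: a_def)
    show "((\<lambda>y. A + a * cos y) has_real_derivative - a * sin x) (at x)"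
      by (auto intro!: derivative_eq_intros)
  qed (rule nz)
  have dux: "(ux has_real_derivative uxx x) (at x)" for x
  proof -
    have d1: "((\<lambda>y. - a * sin y) has_real_derivative - a * cos x) (at x)"
      by (auto intro!: derivative_eq_intros)
    have d2: "((\<lambda>y. 1 + \<epsilon> / u y) has_real_derivative - \<epsilon> * ux x / (u x * u x)) (at x)"
      using nz(1)[of x] by (auto intro!: derivative_eq_intros du)
    have "((\<lambda>y. - a * sin y / (1 + \<epsilon> / u y)) has_real_derivative uxx x) (at x)"
      unfolding uxx_def by (rule DERIV_divide[OF d1 d2 nz(2)])
    moreover have "ux = (\<lambda>y. - a * sin y / (1 + \<epsilon> / u y))" by (rule ext) (rule ux_def)
    ultimately show ?thesis by simp
  qed
  have cx: "continuous_on UNIV ux" using dux DERIV_isCont continuous_at_imp_continuous_on by blast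
  have cxx: "continuous_on UNIV uxx"
    unfolding uxx_def[abs_def] using u(1) cx nz by (intro continuous_intros) auto
  have perx: "ux (x + 2 * pi) = ux x" for x by (simp add: ux_def per)
  have perxx: "uxx (x + 2 * pi) = uxx x" for x by (simp add: uxx_def per perx)
  have w1: "has_weak_deriv_per u ux" and w2: "has_weak_deriv_per ux uxx"
    using du dux cx cxx per perx perxx by (auto intro: has_weak_deriv_perI)
  \<comment> \<open>The nonlinear flux balances the diffusive one pointwise, so one more derivative
    cancels \<open>\<epsilon> * uxx\<close> and the time derivative is zero.\<close>
  have flux: "u x * (ux x + a * sin x) = - \<epsilon> * ux x" for x
  proof -
    have "ux x * (1 + \<epsilon> / u x) = - a * sin x" using nz(2)[of x] by (simp add: ux_def)
    then have "u x * (ux x * (1 + \<epsilon> / u x)) = u x * (- a * sin x)" by simp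
    then show ?thesis using nz(1)[of x] by (simp add: algebra_simps)
  qed
  have conv: "(1 / pi + \<kappa>) * per_conv cos u x = a * cos x" for x
    unfolding per_conv_cos_even[OF u(1) ev] M a_def by simp
  have w3: "has_weak_deriv_per (\<lambda>x. u x - (1 / pi + \<kappa>) * per_conv cos u x) (\<lambda>x. ux x + a * sin x)"
    unfolding conv
    by (rule has_weak_deriv_perI) (auto intro!: derivative_eq_intros continuous_intros du cx simp: per perx)
  have w4: "has_weak_deriv_per (\<lambda>x. u x * (ux x + a * sin x)) (\<lambda>x. - \<epsilon> * uxx x)"
    unfolding flux
    by (rule has_weak_deriv_perI) (auto intro!: derivative_eq_intros continuous_intros dux cxx simp: perx perxx)
  have H2: "H2_per u"
    unfolding H2_per_def using u(1) w1 w2 cx cxx per perx perxx by (blast intro: L2_perI)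
  show "diffusive_vlasov_solution \<epsilon> \<kappa> (\<lambda>t. u)"
    unfolding diffusive_vlasov_solution_def
  proof (intro conjI allI exI)
    show "AE x in lborel. ((\<lambda>s. u x) has_real_derivative \<epsilon> * uxx x + - \<epsilon> * uxx x) (at t)" for t by simp
  qed (fact H2 w1 w2 w3 w4)+
qed

section \<open>Assembling the branch of solutions and its expansion\<close>

theorem proposition6p1:
  shows "(\<forall>\<rho>::real. 0 < \<rho> \<and> \<rho> < 1 \<longrightarrow>
      (\<exists>\<epsilon>0::real. \<epsilon>0 > 0 \<and>
        (\<exists>(mu_star :: real \<Rightarrow> real) (u_star :: real \<Rightarrow> real \<Rightarrow> real).
          (\<forall>\<epsilon>. 0 \<le> \<epsilon> \<and> \<epsilon> < \<epsilon>0 \<longrightarrow>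
             diffusive_vlasov_solution \<epsilon> (mu_star \<epsilon>) (\<lambda>t. u_star \<epsilon>) \<and>
             (\<forall>x. u_star \<epsilon> (- x) = u_star \<epsilon> x) \<and>
             (LINT x:{-pi..pi}|lborel. u_star \<epsilon> x) = 2 * pi \<and>
             (LINT x:{-pi..pi}|lborel. cos x * u_star \<epsilon> x) = \<rho> * pi) \<and>
          (\<exists>C. \<forall>\<epsilon>. 0 \<le> \<epsilon> \<and> \<epsilon> < \<epsilon>0 \<longrightarrow> \<bar>mu_star \<epsilon> - \<epsilon> * mu_1 \<rho>\<bar> \<le> C * \<epsilon>\<^sup>2) \<and>
          (\<exists>C. \<forall>\<epsilon>. 0 \<le> \<epsilon> \<and> \<epsilon> < \<epsilon>0 \<longrightarrow> (\<forall>x. \<bar>u_star \<epsilon> x - (1 + \<rho> * cos x)\<bar> \<le> C * \<epsilon>)))))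
    \<and> (mu_1 \<longlongrightarrow> 1 / pi) (at_right 0)
    \<and> (mu_1 \<longlongrightarrow> 2 / pi) (at_left 1)"
proof (intro conjI allI impI)
  fix \<rho> :: real
  assume "0 < \<rho> \<and> \<rho> < 1"
  then have r: "0 < \<rho>" "\<rho> < 1" by auto
  define m where "m = 1 - \<rho>"
  define L where "L = - ln (m / 2)"
  have m: "0 < m" "m < 1" using r by (auto simp: m_def)
  have L: "0 < L" using m by (simp add: L_def)
  \<comment> \<open>The two entries are the smallness conditions of
    \<open>log_fixed_point\<close>.\<close>
  define \<epsilon>0 where "\<epsilon>0 = min (m / 16) (m / (8 * L))"
  have e0: "0 < \<epsilon>0" using m L by (simp add: \<epsilon>0_def)
  define P where "P \<epsilon> u \<longleftrightarrow> continuous_on UNIV u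
      \<and> (\<forall>x. u x = 1 + \<rho> * cos x - \<epsilon> * strip_modes (\<lambda>y. ln (u y)) x)
      \<and> (\<forall>x. m / 2 \<le> u x \<and> \<bar>u x - (1 + \<rho> * cos x)\<bar> \<le> 4 * L * \<epsilon>)" for \<epsilon> :: real and u :: "real \<Rightarrow> real"
  have "\<exists>u. P \<epsilon> u" if "\<epsilon> \<in> {0..<\<epsilon>0}" for \<epsilon>
  proof -
    have *: "0 \<le> \<epsilon>" "16 * \<epsilon> \<le> m" "8 * \<epsilon> * L \<le> m"
      using that L by (auto simp: \<epsilon>0_def field_simps)
    show ?thesis
      unfolding P_def L_def m_def
      by (rule log_fixed_point[OF r]) (use * in \<open>simp_all add: L_def m_def\<close>)
  qed
  then obtain u where "\<forall>\<epsilon>\<in>{0..<\<epsilon>0}. P \<epsilon> (u \<epsilon>)"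
    using bchoice[of "{0..<\<epsilon>0}" P] by blast
  then have P: "P \<epsilon> (u \<epsilon>)" if "0 \<le> \<epsilon>" "\<epsilon> < \<epsilon>0" for \<epsilon> using that by simp
  note P' = P[unfolded P_def]
  have u: "continuous_on UNIV (u \<epsilon>)"
    and fp: "u \<epsilon> x = 1 + \<rho> * cos x - \<epsilon> * strip_modes (\<lambda>y. ln (u \<epsilon> y)) x"
    and lower: "m / 2 \<le> u \<epsilon> x"
    and dev: "\<bar>u \<epsilon> x - (1 + \<rho> * cos x)\<bar> \<le> 4 * L * \<epsilon>"
    if "0 \<le> \<epsilon>" "\<epsilon> < \<epsilon>0" for \<epsilon> x
    using conjunct1[OF P'[OF that]] spec[OF conjunct1[OF conjunct2[OF P'[OF that]]], of x]
      spec[OF conjunct2[OF conjunct2[OF P'[OF that]]], of x]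
    by (iprover+)
  define J where "J \<epsilon> = integral {-pi..pi} (\<lambda>x. cos x * ln (u \<epsilon> x))" for \<epsilon>
  \<comment> \<open>Solved from \<open>(1 / pi + \<mu> \<epsilon>) * (\<rho> * pi) = \<rho> +
    \<epsilon> * J \<epsilon> / pi\<close>, which equates the coefficients of
    \<open>cos x\<close>.\<close>
  define \<mu> where "\<mu> \<epsilon> = \<epsilon> / (pi\<^sup>2 * \<rho>) * J \<epsilon>" for \<epsilon>
  have pos: "0 < u \<epsilon> x" if "0 \<le> \<epsilon>" "\<epsilon> < \<epsilon>0" for \<epsilon> x
    using lower[OF that, of x] m by linarith
  have lnc: "continuous_on UNIV (\<lambda>y. ln (u \<epsilon> y))" if "0 \<le> \<epsilon>" "\<epsilon> < \<epsilon>0" for \<epsilon>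
    using u[OF that] pos[OF that] by (intro continuous_intros) (auto simp: less_imp_neq[symmetric])
  have sol: "diffusive_vlasov_solution \<epsilon> (\<mu> \<epsilon>) (\<lambda>t. u \<epsilon>) \<and> (\<forall>x. u \<epsilon> (- x) = u \<epsilon> x) \<and>
      (LINT x:{-pi..pi}|lborel. u \<epsilon> x) = 2 * pi \<and>
      (LINT x:{-pi..pi}|lborel. cos x * u \<epsilon> x) = \<rho> * pi" if e: "0 \<le> \<epsilon>" "\<epsilon> < \<epsilon>0" for \<epsilon>
  proof -
    define q where "q = strip_modes (\<lambda>y. ln (u \<epsilon> y))"
    have q: "continuous_on {-pi..pi} q" "integral {-pi..pi} q = 0"
      "integral {-pi..pi} (\<lambda>x. cos x * q x) = 0"
      using lnc[OF e] continuous_on_subset[OF continuous_on_strip_modes[OF lnc[OF e]]]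
      by (auto simp: q_def integral_strip_modes)
    have ue: "u \<epsilon> = (\<lambda>x. 1 + \<rho> * cos x - \<epsilon> * q x)"
      unfolding q_def by (rule ext) (rule fp[OF e])
    have hq: "(q has_integral 0) {-pi..pi}"
      using integrable_integral[OF integrable_continuous_real[OF q(1)]] q(2) by simp
    have hcq: "((\<lambda>x. cos x * q x) has_integral 0) {-pi..pi}"
      using integrable_integral[OF integrable_continuous_real[of "-pi" pi "\<lambda>x. cos x * q x"]] q
      by (simp add: continuous_intros)
    have hc: "(cos has_integral (0::real)) {-pi..pi}"
      using integrable_integral[OF integrable_continuous_real[of "-pi" pi "cos::real\<Rightarrow>real"]]
      by (simp add: integral_cos_period continuous_intros)
    have hcc: "((\<lambda>x. cos x * cos x) has_integral (pi::real)) {-pi..pi}"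
      using integrable_integral[OF integrable_continuous_real[of "-pi" pi "\<lambda>x. cos x * cos x::real"]]
      by (simp add: integral_cos_squared_period continuous_intros)
    have I0: "(u \<epsilon> has_integral 2 * pi) {-pi..pi}"
      using has_integral_diff[OF has_integral_add[OF has_integral_const_real[of 1 "-pi" pi]
            has_integral_mult_right[OF hc, of \<rho>]] has_integral_mult_right[OF hq, of \<epsilon>]]
      by (simp add: ue)
    have "((\<lambda>x. cos x + \<rho> * (cos x * cos x) - \<epsilon> * (cos x * q x)) has_integral \<rho> * pi) {-pi..pi}"
      using has_integral_diff[OF has_integral_add[OF hc
            has_integral_mult_right[OF hcc, of \<rho>]] has_integral_mult_right[OF hcq, of \<epsilon>]]
      by simp
    then have I1: "((\<lambda>x. cos x * u \<epsilon> x) has_integral \<rho> * pi) {-pi..pi}"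
      by (simp add: ue algebra_simps)
    \<comment> \<open>The constant mode, restored after \<open>strip_modes\<close> has removed it
      from the logarithm.\<close>
    define A where "A = 1 + \<epsilon> * integral {-pi..pi} (\<lambda>y. ln (u \<epsilon> y)) / (2 * pi)"
    have ode: "u \<epsilon> x + \<epsilon> * ln (u \<epsilon> x) = A + (1 / pi + \<mu> \<epsilon>) * (\<rho> * pi) * cos x" for x
    proof -
      have "(1 / pi + \<mu> \<epsilon>) * (\<rho> * pi) = \<rho> + \<epsilon> * J \<epsilon> / pi"
        using r by (simp add: \<mu>_def field_simps power2_eq_square)
      moreover have "u \<epsilon> x = 1 + \<rho> * cos x - \<epsilon> * q x" by (simp only: ue)
      then have "u \<epsilon> x + \<epsilon> * ln (u \<epsilon> x) = 1 + \<rho> * cos x + \<epsilon> * (ln (u \<epsilon> x) - q x)"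
        unfolding right_diff_distrib by linarith
      moreover have "ln (u \<epsilon> x) - q x = integral {-pi..pi} (\<lambda>y. ln (u \<epsilon> y)) / (2 * pi) + cos x * (J \<epsilon> / pi)"
        by (simp add: q_def strip_modes_def J_def)
      ultimately show ?thesis by (simp add: A_def algebra_simps)
    qed
    note steady = steady_state_solution[OF e(1) u[OF e] pos[OF e] ode integral_unique[OF I1]]
    have c: "continuous_on {-pi..pi} (u \<epsilon>)" using u[OF e] continuous_on_subset by blast
    then have "continuous_on {-pi..pi} (\<lambda>x. cos x * u \<epsilon> x)" by (intro continuous_intros)
    then show ?thesis
      using c steady integral_unique[OF I0] integral_unique[OF I1]
      by (simp add: set_lebesgue_integral_eq_integral_continuous)
  qed
  \<comment> \<open>The deviation \<open>4 * L * \<epsilon>\<close> of \<open>u\<close>, the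
    Lipschitz constant \<open>2 / m\<close> of \<open>ln\<close> and the period
    \<open>2 * pi\<close> bound the change in \<open>J\<close>; the prefactor
    \<open>\<epsilon> / (pi^2 * \<rho>)\<close> supplies the second power of
    \<open>\<epsilon>\<close>.\<close>
  have mu: "\<bar>\<mu> \<epsilon> - \<epsilon> * mu_1 \<rho>\<bar> \<le> 16 * L / (pi * \<rho> * m) * \<epsilon>\<^sup>2" if e: "0 \<le> \<epsilon>" "\<epsilon> < \<epsilon>0" for \<epsilon>
  proof -
    define J0 where "J0 = integral {-pi..pi} (\<lambda>x. cos x * ln (1 + \<rho> * cos x))"
    have p: "m \<le> 1 + \<rho> * cos x" for x
    proof -
      have "\<bar>\<rho> * cos x\<bar> \<le> \<rho>" using r mult_left_mono[OF abs_cos_le_one[of x], of \<rho>] by (simp add: abs_mult)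
      then show ?thesis unfolding m_def by linarith
    qed
    have p': "0 < 1 + \<rho> * cos x" for x using p[of x] m by linarith
    have lc: "continuous_on UNIV (\<lambda>x. ln (1 + \<rho> * cos x))"
      using p' by (intro continuous_intros) (auto simp: less_imp_neq[symmetric])
    have b: "\<bar>ln (u \<epsilon> x) - ln (1 + \<rho> * cos x)\<bar> \<le> 8 * L * \<epsilon> / m" for x
    proof -
      have "\<bar>ln (u \<epsilon> x) - ln (1 + \<rho> * cos x)\<bar> \<le> \<bar>u \<epsilon> x - (1 + \<rho> * cos x)\<bar> / (m / 2)"
        using lower[OF e, of x] p[of x] m by (intro abs_ln_diff_le) auto
      also have "\<dots> \<le> 4 * L * \<epsilon> / (m / 2)" using dev[OF e, of x] m by (intro divide_right_mono) auto
      finally show ?thesis by simp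
    qed
    have ii: "(\<lambda>x. cos x * f x) integrable_on {-pi..pi}" if "continuous_on UNIV f" for f :: "real \<Rightarrow> real"
      by (intro integrable_continuous_real continuous_on_mult continuous_on_cos continuous_on_id
          continuous_on_subset[OF that]) auto
    have "J \<epsilon> - J0 = integral {-pi..pi} (\<lambda>x. cos x * (ln (u \<epsilon> x) - ln (1 + \<rho> * cos x)))"
      unfolding J_def J0_def integral_diff[OF ii[OF lnc[OF e]] ii[OF lc], symmetric] by (simp add: right_diff_distrib)
    also have "\<bar>\<dots>\<bar> \<le> 8 * L * \<epsilon> / m * (2 * pi)"
      by (rule abs_integral_period_le(2)[OF continuous_on_diff[OF lnc[OF e] lc] b])
    finally have JJ: "\<bar>J \<epsilon> - J0\<bar> \<le> 8 * L * \<epsilon> / m * (2 * pi)" .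
    \<comment> \<open>The explicit integral identifies the leading coefficient.\<close>
    have "mu_1 \<rho> = J0 / (pi\<^sup>2 * \<rho>)"
      unfolding J0_def integral_cos_ln_one_plus_cos[OF r] mu_1_def
      using r by (simp add: power2_eq_square)
    then have "\<mu> \<epsilon> - \<epsilon> * mu_1 \<rho> = \<epsilon> / (pi\<^sup>2 * \<rho>) * (J \<epsilon> - J0)"
      by (simp add: \<mu>_def right_diff_distrib)
    then have "\<bar>\<mu> \<epsilon> - \<epsilon> * mu_1 \<rho>\<bar> = \<epsilon> / (pi\<^sup>2 * \<rho>) * \<bar>J \<epsilon> - J0\<bar>"
      using e r by (simp add: abs_mult)
    also have "\<dots> \<le> \<epsilon> / (pi\<^sup>2 * \<rho>) * (8 * L * \<epsilon> / m * (2 * pi))"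
      using JJ e r by (intro mult_left_mono) auto
    also have "\<dots> = 16 * L / (pi * \<rho> * m) * \<epsilon>\<^sup>2"
      using r m by (simp add: field_simps power2_eq_square)
    finally show ?thesis .
  qed
  show "\<exists>\<epsilon>0>0. \<exists>mu_star u_star.
          (\<forall>\<epsilon>. 0 \<le> \<epsilon> \<and> \<epsilon> < \<epsilon>0 \<longrightarrow>
             diffusive_vlasov_solution \<epsilon> (mu_star \<epsilon>) (\<lambda>t. u_star \<epsilon>) \<and>
             (\<forall>x. u_star \<epsilon> (- x) = u_star \<epsilon> x) \<and>
             (LINT x:{-pi..pi}|lborel. u_star \<epsilon> x) = 2 * pi \<and>
             (LINT x:{-pi..pi}|lborel. cos x * u_star \<epsilon> x) = \<rho> * pi) \<and>
          (\<exists>C. \<forall>\<epsilon>. 0 \<le> \<epsilon> \<and> \<epsilon> < \<epsilon>0 \<longrightarrow> \<bar>mu_star \<epsilon> - \<epsilon> * mu_1 \<rho>\<bar> \<le> C * \<epsilon>\<^sup>2) \<and>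
          (\<exists>C. \<forall>\<epsilon>. 0 \<le> \<epsilon> \<and> \<epsilon> < \<epsilon>0 \<longrightarrow> (\<forall>x. \<bar>u_star \<epsilon> x - (1 + \<rho> * cos x)\<bar> \<le> C * \<epsilon>))"
    by (rule exI[of _ \<epsilon>0], intro conjI e0, rule exI[of _ \<mu>], rule exI[of _ u], intro conjI,
        use sol in blast, rule exI[of _ "16 * L / (pi * \<rho> * m)"], use mu in blast,
        rule exI[of _ "4 * L"], use dev in blast)
next
  show "(mu_1 \<longlongrightarrow> 1 / pi) (at_right 0)"
    unfolding mu_1_def by real_asymp (simp add: inverse_eq_divide)
next
  show "(mu_1 \<longlongrightarrow> 2 / pi) (at_left 1)"
    unfolding mu_1_def by real_asymp (simp add: divide_inverse)
qed

end
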